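(* Let $N\ge1$ be an integer. For all analytic sets $E\subset\mathbf{R}^N$ and all $s\in(0,\infty]$, $$\mathrm{B}\text{-}\overline{\dim}_s\,E=\limsup_{r\downarrow0}\frac{\log\mathscr{Z}_s(r;E)}{\log r},$$ where $\mathrm{B}\text{-}\overline{\dim}_s$ is the $s$-dimensional upper box dimension (defined through weighted $\psi_s$-packings) and $$\mathscr{Z}_s(r;E):=\inf_{\mu\in\mathscr{P}(E)}\iint\psi_s\!\left(\frac{x-y}{r}\right)\mu(dy)\,\mu(dx),$$ the infimum being over the collection $\mathscr{P}(E)$ of all probability measures $\mu$ on $\mathbf{R}^N$ with $\mu(E)=1$.
   Context: $|\cdot|$ denotes the Euclidean norm. For $s\in(0,\infty)$, $\psi_s(x):=\min(1,|x|^{-s})$ for $x\in\mathbf{R}^N$ (so $\psi_s(0)=1$), and $\psi_\infty:=\mathbf{1}_{\{y\in\mathbf{R}^N:\,|y|\le1\}}$. Probability measures are Borel; for analytic $E$ (which is universally measurable) $\mu(E)$ is understood via the completion of $\mu$. **$s$-dimensional upper box dimension.** For $r>0$ and $E\subset\mathbf{R}^N$, a finite sequence of pairs $(w_i,x_i)_{i=1}^k$ is a size-$r$ weighted $\psi_s$-packing of $E$ if $x_i\in E$, $w_i\ge0$ for all $i$, and $$\max_{1\le i\le k}\sum_{j=1}^kw_j\,\psi_s\!\left(\frac{x_i-x_j}{r}\right)\le1.$$ Define $$N_r(E;\psi_s):=\sup\Big\{\sum_{i=1}^kw_i:\ (w_i,x_i)_{i=1}^k\text{ is a size-}r\text{ weighted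 }\psi_s\text{-packing of }E\Big\}$$ (equal to $0$ if $E=\varnothing$) and $$\mathrm{B}\text{-}\overline{\dim}_s\,E:=\limsup_{r\downarrow0}\frac{\log N_r(E;\psi_s)}{\log(1/r)}.$$ Conventions: $\log0:=-\infty$, $\log\infty:=\infty$, $\inf\varnothing:=\infty$; for $0<r<1$ the quotients are then interpreted in $[-\infty,\infty]$. *)

theory Defs
  imports "HOL-Probability.Probability"
begin

(* Analytic (Suslin) sets of a Polish space: the empty set and the continuous images of the
   Baire space. Here nat carries the discrete topology and nat => nat the product topology. *)
definition analytic_set :: "'a::topological_space set \<Rightarrow> bool" where
  "analytic_set E \<longleftrightarrow>
     E = {} \<or> (\<exists>f :: (nat \<Rightarrow> nat) \<Rightarrow> 'a. continuous_on UNIV f \<and> range f = E)"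

(* For finite s the value at 0 is given separately, because 0 powr a = 0 in HOL. *)
definition psi :: "ennreal \<Rightarrow> 'a::real_normed_vector \<Rightarrow> real" where
  "psi s x =
     (if s = \<infinity> then indicator {y. norm y \<le> 1} x
      else if x = 0 then 1
      else min 1 (norm x powr (- enn2real s)))"

(* The finite sequence of pairs (w i, x i) is indexed by i = 1, ..., k with k >= 1; the values
   of w and x outside of this range are irrelevant. *)
definition weighted_packing ::
    "ennreal \<Rightarrow> real \<Rightarrow> 'a::real_normed_vector set \<Rightarrow> nat \<Rightarrow> (nat \<Rightarrow> real) \<Rightarrow> (nat \<Rightarrow> 'a) \<Rightarrow> bool"
  where
  "weighted_packing s r E k w x \<longleftrightarrow>
     1 \<le> k \<and> (\<forall>i\<in>{1..k}. x i \<in> E \<and> 0 \<le> w i) \<and>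
     (MAX i\<in>{1..k}. \<Sum>j=1..k. w j * psi s ((x i - x j) /\<^sub>R r)) \<le> 1"

(* An empty supremum in ennreal is 0, so the packing number of the empty set is 0. *)
definition packing_number :: "ennreal \<Rightarrow> real \<Rightarrow> 'a::real_normed_vector set \<Rightarrow> ennreal" where
  "packing_number s r E =
     Sup {ennreal (\<Sum>i=1..k. w i) | k w x. weighted_packing s r E k w x}"

definition elog :: "ennreal \<Rightarrow> ereal" where
  "elog x = (if x = 0 then -\<infinity> else if x = \<infinity> then \<infinity> else ereal (ln (enn2real x)))"

definition upper_box_dim :: "ennreal \<Rightarrow> 'a::real_normed_vector set \<Rightarrow> ereal" where
  "upper_box_dim s E =
     Limsup (at_right 0) (\<lambda>r. elog (packing_number s r E) / ereal (ln (1 / r)))"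

(* The emeasure of a set outside of the sigma-algebra is 0, so the last condition also says that
   E is measurable for the completion, which holds automatically for analytic E. *)
definition prob_measures_on :: "'a::topological_space set \<Rightarrow> 'a measure set" where
  "prob_measures_on E =
     {\<mu>. prob_space \<mu> \<and> sets \<mu> = sets borel \<and> emeasure (completion \<mu>) E = 1}"

(* An empty infimum in ennreal is \<infinity>. *)
definition min_energy :: "ennreal \<Rightarrow> real \<Rightarrow> 'a::real_normed_vector set \<Rightarrow> ennreal" where
  "min_energy s r E =
     (INF \<mu>\<in>prob_measures_on E. \<integral>\<^sup>+ x. (\<integral>\<^sup>+ y. ennreal (psi s ((x - y) /\<^sub>R r)) \<partial>\<mu>) \<partial>\<mu>)"

end

theory Submission
  imports Defs
begin

text \<open>
  Write \<open>N\<close> for the packing number and \<open>Z\<close> for the minimal energy at scale \<open>r\<close>. Then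
  \<open>c / N \<le> Z \<le> 1 / N\<close> with \<open>c > 0\<close> independent of \<open>r\<close>, and the constant disappears after
  division by \<open>ln r\<close>. For the upper bound, the normalised weights of a packing of total weight
  \<open>W\<close> form a probability measure of energy at most \<open>1 / W\<close>. For the lower bound, let \<open>\<mu>\<close> have
  energy below \<open>t\<close>. By Markov's inequality the potential of \<open>\<mu>\<close> is at most \<open>2 * t\<close> on a Borel
  set \<open>A \<subseteq> E\<close> of measure at least \<open>1/2\<close>. Cut \<open>A\<close> into pieces of diameter at most \<open>r\<close> and
  place the mass of each piece at one of its points. For finite \<open>s\<close>, \<open>psi\<close> varies by bounded
  factors at unit scale, and for infinite \<open>s\<close> a covering argument replaces this; so the
  potentials at these points are still of order \<open>t\<close>, and finitely many of the masses
  divided by a multiple of \<open>t\<close> form a packing of total weight of order \<open>1 / t\<close>.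
\<close>

section \<open>Limits superior of logarithmic quotients\<close>

lemma Limsup_le_add_tendsto_0:
  fixes f g :: "'a \<Rightarrow> ereal" and h :: "'a \<Rightarrow> real"
  assumes le: "\<forall>\<^sub>F x in F. g x \<le> f x + ereal (h x)" and h: "(h \<longlongrightarrow> 0) F"
  shows "Limsup F g \<le> Limsup F f"
  unfolding Limsup_le_iff
proof (intro allI impI)
  fix y assume "Limsup F f < y"
  \<comment> \<open>Two reals strictly between the limit superior and \<open>y\<close>: eventually
    \<open>f\<close> is below \<open>a\<close>, and the gap \<open>b - a\<close> absorbs the error
    \<open>h\<close>.\<close>
  then obtain b where b: "Limsup F f < ereal b" "ereal b < y"
    using ereal_dense2 by blast
  then obtain a where a: "Limsup F f < ereal a" "a < b"
    using ereal_dense2 by (metis ereal_less_eq(3) less_le_not_le linorder_not_le)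
  have "\<forall>\<^sub>F x in F. f x < ereal a"
    using a(1) by (rule Limsup_lessD)
  moreover have "\<forall>\<^sub>F x in F. h x < b - a"
    using order_tendstoD(2)[OF h] a(2) by simp
  ultimately show "\<forall>\<^sub>F x in F. g x < y"
    using le
  proof eventually_elim
    case (elim x)
    then have "g x \<le> ereal a + ereal (h x)"
      by (meson add_right_mono less_imp_le order_trans)
    also have "\<dots> < ereal b"
      using elim by simp
    finally show ?case
      using b(2) by order
  qed
qed

text \<open>Dividing by \<open>ln r < 0\<close> reverses the order, so the upper bound on
  \<open>z\<close> gives the first inequality and the lower bound gives the second. In the
  degenerate cases \<open>n = top\<close> forces \<open>z = 0\<close> and \<open>n = 0\<close>
  forces \<open>z = top\<close>; both quotients are then the same infinite value.\<close>

lemma elog_quotient_bounds: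
  fixes n z :: ennreal
  assumes c: "0 < c" and lower: "ennreal c * inverse n \<le> z" and upper: "z \<le> inverse n"
    and r: "0 < r" "r < 1"
  shows "elog n / ereal (ln (1 / r)) \<le> elog z / ereal (ln r)"
    and "elog z / ereal (ln r) \<le> elog n / ereal (ln (1 / r)) + ereal (- ln c / ln (1 / r))"
proof -
  have neg: "ln r < 0"
    using r by simp
  have "elog n / ereal (ln (1 / r)) \<le> elog z / ereal (ln r) \<and>
    elog z / ereal (ln r) \<le> elog n / ereal (ln (1 / r)) + ereal (- ln c / ln (1 / r))"
  proof (cases n)
    case top
    with upper show ?thesis
      using neg r by (simp add: elog_def ln_div divide_ereal_def)
  next
    case (real a)
    show ?thesis
    proof (cases "a = 0")
      case True
      then have "z = top"
        using lower real c by (simp add: ennreal_mult_top top_unique)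
      then show ?thesis
        using True real neg r by (simp add: elog_def ln_div divide_ereal_def)
    next
      case False
      then have a: "0 < a"
        using real by simp
      have inv: "inverse n = ennreal (inverse a)"
        using real a by (simp add: inverse_ennreal)
      obtain b where b: "z = ennreal b" "0 \<le> b"
        using upper inv by (cases z) (auto simp: top_unique)
      have ba: "c / a \<le> b" "b \<le> 1 / a"
        using lower upper b c a unfolding inv
        by (simp_all add: ennreal_mult[symmetric] divide_inverse)
      then have pos: "0 < b"
        using c a by (meson divide_pos_pos less_le_trans)
      have "ln c - ln a \<le> ln b" "ln b \<le> - ln a"
        using ln_mono[OF ba(1)] ln_mono[OF ba(2)] a c pos by (simp_all add: ln_div)
      then show ?thesis
        using a pos b(1) real neg r by (simp add: elog_def ln_div field_simps)
    qed
  qed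
  then show "elog n / ereal (ln (1 / r)) \<le> elog z / ereal (ln r)"
    and "elog z / ereal (ln r) \<le> elog n / ereal (ln (1 / r)) + ereal (- ln c / ln (1 / r))"
    by auto
qed

text \<open>A constant factor \<open>c\<close> shifts the quotient by at most
  \<open>- ln c / ln (1 / r)\<close>, which tends to 0. This is why \<open>c\<close> must not depend
  on \<open>r\<close>.\<close>

lemma Limsup_elog_quotient_eq:
  fixes n z :: "real \<Rightarrow> ennreal"
  assumes c: "0 < c" and lower: "\<And>r. 0 < r \<Longrightarrow> ennreal c * inverse (n r) \<le> z r"
    and upper: "\<And>r. 0 < r \<Longrightarrow> z r \<le> inverse (n r)"
  shows "Limsup (at_right 0) (\<lambda>r. elog (n r) / ereal (ln (1 / r))) =
    Limsup (at_right 0) (\<lambda>r. elog (z r) / ereal (ln r))"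
proof (rule antisym)
  have small: "\<forall>\<^sub>F r in at_right (0::real). 0 < r \<and> r < 1"
    by (auto simp: eventually_at_right_field intro!: exI[of _ 1])
  show "Limsup (at_right 0) (\<lambda>r. elog (n r) / ereal (ln (1 / r))) \<le>
      Limsup (at_right 0) (\<lambda>r. elog (z r) / ereal (ln r))"
    using small
    by (intro Limsup_mono, eventually_elim) (use elog_quotient_bounds(1)[OF c] lower upper in blast)
  show "Limsup (at_right 0) (\<lambda>r. elog (z r) / ereal (ln r)) \<le>
      Limsup (at_right 0) (\<lambda>r. elog (n r) / ereal (ln (1 / r)))"
  proof (rule Limsup_le_add_tendsto_0)
    show "\<forall>\<^sub>F r in at_right 0. elog (z r) / ereal (ln r) \<le>
        elog (n r) / ereal (ln (1 / r)) + ereal (- ln c / ln (1 / r))"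
      using small by eventually_elim (use elog_quotient_bounds(2)[OF c] lower upper in blast)
    have "filterlim (\<lambda>r::real. ln (1 / r)) at_top (at_right 0)"
      by (rule filterlim_compose[OF ln_at_top])
        (simp add: divide_inverse filterlim_inverse_at_top_right)
    then show "((\<lambda>r. - ln c / ln (1 / r)) \<longlongrightarrow> 0) (at_right 0)"
      by (rule real_tendsto_divide_at_top[OF tendsto_const])
  qed
qed

section \<open>The kernel \<open>psi\<close> and its enlargement\<close>

lemma psi_nonneg: "0 \<le> psi s x"
  by (simp add: psi_def)

lemma borel_measurable_psi [measurable]:
  "psi s \<in> borel_measurable (borel :: 'a::euclidean_space measure)"
proof -
  have *: "{y::'a. norm y \<le> 1} \<in> sets borel"
    by measurable
  show ?thesis
    unfolding psi_def[abs_def] using * by measurable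
qed

lemma norm_diff_scaleR_inverse_le_iff:
  fixes x y :: "'a::real_normed_vector"
  assumes "0 < r"
  shows "norm ((x - y) /\<^sub>R r) \<le> d \<longleftrightarrow> dist x y \<le> d * r"
proof -
  have "norm ((x - y) /\<^sub>R r) = dist x y / r"
    using assms by (simp add: dist_norm divide_inverse mult.commute)
  with assms show ?thesis
    by (simp add: pos_divide_le_eq)
qed

text \<open>A majorant of \<open>psi\<close> under shifts of the argument by at most 1. A constant
  factor suffices for finite \<open>s\<close>; for infinite \<open>s\<close> the kernel vanishes off
  the unit ball, so the ball itself has to grow.\<close>

definition fat_psi :: "ennreal \<Rightarrow> 'a::real_normed_vector \<Rightarrow> real" where
  "fat_psi s x =
     (if s = \<infinity> then indicator (cball 0 2) x else 2 powr enn2real s * psi s x)"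

lemma borel_measurable_fat_psi [measurable]:
  "fat_psi s \<in> borel_measurable (borel :: 'a::euclidean_space measure)"
proof (cases "s = \<infinity>")
  case True
  then show ?thesis
    by (simp add: fat_psi_def[abs_def] borel_measurable_indicator)
next
  case False
  then show ?thesis
    by (simp add: fat_psi_def[abs_def])
qed

text \<open>Everything rests on \<open>norm v \<le> norm u + 1\<close>, which is at most twice the
  larger of 1 and \<open>norm u\<close>. Hence the radius 2 for infinite \<open>s\<close> and the
  factor \<open>2 powr p\<close> for finite \<open>s\<close>.\<close>

lemma psi_le_fat_psi:
  assumes "norm (u - v) \<le> 1"
  shows "psi s u \<le> fat_psi s v"
proof (cases "s = \<infinity>")
  case True
  have "norm v \<le> norm u + norm (u - v)"
    by (metis norm_minus_commute norm_triangle_sub)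
  with True assms show ?thesis
    by (auto simp: psi_def fat_psi_def indicator_def)
next
  case False
  define p where "p = enn2real s"
  have p: "0 \<le> p"
    by (simp add: p_def)
  have uv: "norm v \<le> norm u + 1"
    using assms by (smt (verit) norm_minus_commute norm_triangle_sub)
  have two: "1 \<le> 2 powr p"
    using p by (simp add: ge_one_powr_ge_zero)
  \<comment> \<open>This form removes both the minimum and the special value at 0, leaving only a
    split at norm 1.\<close>
  have psi: "psi s x = (if norm x \<le> 1 then 1 else norm x powr - p)" for x :: 'a
  proof (cases "norm x \<le> 1")
    case True
    then have "1 \<le> norm x powr - p" if "x \<noteq> 0"
      using that p powr_mono2'[of "- p" "norm x" 1] by simp
    with True show ?thesis
      using False by (auto simp: psi_def p_def)
  next
    case big: False
    then have "norm x powr - p \<le> 1"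
      using p powr_mono2'[of "- p" 1 "norm x"] by simp
    with big show ?thesis
      using False by (auto simp: psi_def p_def)
  qed
  have "psi s u \<le> 2 powr p * psi s v"
  proof (cases "norm v \<le> 1")
    case True
    have "psi s u \<le> 1"
      using False by (simp add: psi_def)
    with True two show ?thesis
      by (simp add: psi)
  next
    case big: False
    show ?thesis
    proof (cases "norm u \<le> 1")
      case True
      then have "norm v / 2 \<le> 1"
        using uv by simp
      moreover have "0 < norm v / 2"
        using big by linarith
      ultimately have "1 \<le> (norm v / 2) powr - p"
        using p powr_mono2'[of "- p" "norm v / 2" 1] by simp
      then show ?thesis
        using True big by (simp add: psi powr_divide powr_minus field_simps)
    next
      case False
      then have "norm v / 2 \<le> norm u"
        using uv by simp
      then have "norm u powr - p \<le> (norm v / 2) powr - p"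
        using big p by (intro powr_mono2') auto
      then show ?thesis
        using False big by (simp add: psi powr_divide powr_minus field_simps)
    qed
  qed
  with False show ?thesis
    by (simp add: fat_psi_def p_def)
qed

text \<open>
  For infinite \<open>s\<close> the potential bound is only available at points of \<open>A\<close>, so the ball of
  radius \<open>2 * r\<close> is covered by boundedly many sets, each of which is either disjoint from \<open>A\<close>
  or contained in a ball of radius \<open>r\<close> centred in \<open>A\<close>.
\<close>
lemma fat_potential_bound:
  fixes s :: ennreal
  obtains C where "0 < C" and "\<And>(\<mu> :: 'a::euclidean_space measure) A r t x.
    sets \<mu> = sets borel \<Longrightarrow> A \<in> sets borel \<Longrightarrow> 0 < r \<Longrightarrow>
    (\<And>a. a \<in> A \<Longrightarrow> (\<integral>\<^sup>+ y. ennreal (psi s ((a - y) /\<^sub>R r)) \<partial>\<mu>) \<le> t) \<Longrightarrow> x \<in> A \<Longrightarrow>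
    (\<integral>\<^sup>+ y. ennreal (fat_psi s ((x - y) /\<^sub>R r)) * indicator A y \<partial>\<mu>) \<le> ennreal C * t"
proof (cases "s = \<infinity>")
  case False
  show ?thesis
  proof (rule that[of "2 powr enn2real s"])
    fix \<mu> :: "'a measure" and A r t x
    assume [measurable_cong]: "sets \<mu> = sets borel" and [measurable]: "A \<in> sets borel" and "0 < r"
      and pot: "\<And>a. a \<in> A \<Longrightarrow> (\<integral>\<^sup>+ y. ennreal (psi s ((a - y) /\<^sub>R r)) \<partial>\<mu>) \<le> t" and "x \<in> A"
    have "(\<integral>\<^sup>+ y. ennreal (fat_psi s ((x - y) /\<^sub>R r)) * indicator A y \<partial>\<mu>) \<le>
        (\<integral>\<^sup>+ y. ennreal (2 powr enn2real s) * ennreal (psi s ((x - y) /\<^sub>R r)) \<partial>\<mu>)"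
      using False
      by (intro nn_integral_mono) (auto simp: fat_psi_def ennreal_mult psi_nonneg indicator_def)
    also have "\<dots> = ennreal (2 powr enn2real s) * (\<integral>\<^sup>+ y. ennreal (psi s ((x - y) /\<^sub>R r)) \<partial>\<mu>)"
      by (rule nn_integral_cmult) measurable
    also have "\<dots> \<le> ennreal (2 powr enn2real s) * t"
      using pot \<open>x \<in> A\<close> by (intro mult_left_mono) auto
    finally show "(\<integral>\<^sup>+ y. ennreal (fat_psi s ((x - y) /\<^sub>R r)) * indicator A y \<partial>\<mu>) \<le>
        ennreal (2 powr enn2real s) * t" .
  qed simp
next
  case True
  have "compact (cball (0::'a) 2)"
    by simp
  moreover have "cball (0::'a) 2 \<subseteq> (\<Union>c\<in>UNIV. ball c (1/2))"
    using centre_in_ball[of _ "1/2"] by fastforce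
  \<comment> \<open>Radius 1/2 puts any two points of a ball, rescaled by \<open>r\<close>, within
    distance \<open>r\<close> of each other. \<open>F\<close> is chosen before the measure,
    \<open>A\<close> and \<open>r\<close>, so its cardinality can serve as the constant.\<close>
  ultimately obtain F :: "'a set" where F: "finite F" "cball 0 2 \<subseteq> (\<Union>c\<in>F. ball c (1/2))"
    by (metis compactE_image open_ball)
  show ?thesis
  \<comment> \<open>Adding 1 makes the constant positive without showing that \<open>F\<close> is
    nonempty.\<close>
  proof (rule that[of "real (card F) + 1"])
    fix \<mu> :: "'a measure" and A r t x
    assume sets_mu [measurable_cong]: "sets \<mu> = sets borel" and [measurable]: "A \<in> sets borel"
      and r: "0 < r"
      and pot: "\<And>a. a \<in> A \<Longrightarrow> (\<integral>\<^sup>+ y. ennreal (psi s ((a - y) /\<^sub>R r)) \<partial>\<mu>) \<le> t" and "x \<in> A"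
    have ball_bound: "emeasure \<mu> (cball a r) \<le> t" if "a \<in> A" for a
    proof -
      have "emeasure \<mu> (cball a r) = (\<integral>\<^sup>+ y. indicator (cball a r) y \<partial>\<mu>)"
        by simp
      also have "\<dots> = (\<integral>\<^sup>+ y. ennreal (psi s ((a - y) /\<^sub>R r)) \<partial>\<mu>)"
        by (intro nn_integral_cong)
          (simp add: True psi_def indicator_def norm_diff_scaleR_inverse_le_iff[OF r] del: norm_scaleR)
      finally show ?thesis
        using pot that by simp
    qed
    \<comment> \<open>The kernel is evaluated at \<open>(x - y) /\<^sub>R r\<close>, so this vector
      is near \<open>c\<close> exactly when \<open>y\<close> is near
      \<open>x - r *\<^sub>R c\<close>.\<close>
    define B where "B c = A \<inter> ball (x - r *\<^sub>R c) (r / 2)" for c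
    have B_meas: "B c \<in> sets \<mu>" for c
      by (simp add: B_def sets_mu)
    have B_bound: "emeasure \<mu> (B c) \<le> t" for c
    proof (cases "B c = {}")
      case False
      then obtain a where a: "a \<in> B c"
        by blast
      have "B c \<subseteq> cball a r"
      proof
        fix b assume "b \<in> B c"
        with a have "dist (x - r *\<^sub>R c) a < r / 2" "dist (x - r *\<^sub>R c) b < r / 2"
          by (auto simp: B_def)
        then show "b \<in> cball a r"
          using dist_triangle2[of a b "x - r *\<^sub>R c"] by (simp add: dist_commute)
      qed
      then have "emeasure \<mu> (B c) \<le> emeasure \<mu> (cball a r)"
        by (intro emeasure_mono) (auto simp: sets_mu)
      then show ?thesis
        using ball_bound[of a] a by (auto simp: B_def)
    qed simp
    have cover: "A \<inter> cball x (2 * r) \<subseteq> (\<Union>c\<in>F. B c)"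
    proof
      fix y assume y: "y \<in> A \<inter> cball x (2 * r)"
      then have "(x - y) /\<^sub>R r \<in> cball 0 2"
        by (simp add: norm_diff_scaleR_inverse_le_iff[OF r] mult.commute del: norm_scaleR)
      then obtain c where c: "c \<in> F" "norm (c - (x - y) /\<^sub>R r) < 1/2"
        using F(2) by (auto simp: dist_norm simp del: norm_scaleR dest: subsetD)
      have "(x - r *\<^sub>R c) - y = - (r *\<^sub>R (c - (x - y) /\<^sub>R r))"
        using r by (simp add: algebra_simps)
      then have "norm ((x - r *\<^sub>R c) - y) = r * norm (c - (x - y) /\<^sub>R r)"
        using r by simp
      also have "\<dots> < r * (1/2)"
        using r c(2) by (intro mult_strict_left_mono)
      finally show "y \<in> (\<Union>c\<in>F. B c)"
        using y c(1) by (auto simp: B_def dist_norm)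
    qed
    have "(\<integral>\<^sup>+ y. ennreal (fat_psi s ((x - y) /\<^sub>R r)) * indicator A y \<partial>\<mu>) =
        (\<integral>\<^sup>+ y. indicator (A \<inter> cball x (2 * r)) y \<partial>\<mu>)"
      by (intro nn_integral_cong)
        (simp add: True fat_psi_def indicator_def norm_diff_scaleR_inverse_le_iff[OF r] mult.commute del: norm_scaleR)
    also have "\<dots> = emeasure \<mu> (A \<inter> cball x (2 * r))"
      by (simp add: sets_mu)
    also have "\<dots> \<le> emeasure \<mu> (\<Union>c\<in>F. B c)"
      using cover F(1) B_meas by (intro emeasure_mono) auto
    also have "\<dots> \<le> (\<Sum>c\<in>F. emeasure \<mu> (B c))"
      using F(1) B_meas by (intro emeasure_subadditive_finite) auto
    also have "\<dots> \<le> (\<Sum>c\<in>F. t)"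
      by (intro sum_mono B_bound)
    also have "\<dots> = ennreal (real (card F)) * t"
      by (simp add: ennreal_of_nat_eq_real_of_nat)
    also have "\<dots> \<le> ennreal (real (card F) + 1) * t"
      by (intro mult_right_mono ennreal_leI) auto
    finally show "(\<integral>\<^sup>+ y. ennreal (fat_psi s ((x - y) /\<^sub>R r)) * indicator A y \<partial>\<mu>) \<le>
        ennreal (real (card F) + 1) * t" .
  qed simp
qed

section \<open>Countable Borel partitions into small pieces\<close>

text \<open>Balls of radius \<open>r / 2\<close> about a countable dense set cover the space, and
  \<open>disjointed\<close> makes them disjoint without enlarging them. Pieces may be empty.\<close>

lemma countable_small_partition:
  fixes r :: real
  assumes "0 < r"
  obtains Q :: "nat \<Rightarrow> 'a::euclidean_space set"
  where "\<And>i. Q i \<in> sets borel" "disjoint_family Q" "(\<Union>i. Q i) = UNIV"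
    "\<And>i x y. x \<in> Q i \<Longrightarrow> y \<in> Q i \<Longrightarrow> dist x y \<le> r"
proof -
  obtain D :: "'a set" where D: "countable D" "\<And>X. open X \<Longrightarrow> X \<noteq> {} \<Longrightarrow> \<exists>d\<in>D. d \<in> X"
    using countable_dense_setE by blast
  then have "D \<noteq> {}"
    by blast
  define B where "B i = ball (from_nat_into D i) (r / 2)" for i
  have cover: "(\<Union>i. B i) = UNIV"
  proof (intro equalityI subsetI UNIV_I)
    fix x :: 'a
    obtain d where d: "d \<in> D" "d \<in> ball x (r / 2)"
      using D(2)[of "ball x (r / 2)"] assms by auto
    then obtain i where "from_nat_into D i = d"
      using from_nat_into_surj[OF D(1)] by blast
    with d show "x \<in> (\<Union>i. B i)"
      by (auto simp: B_def dist_commute)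
  qed
  show ?thesis
  proof (rule that[of "disjointed B"])
    show "disjointed B i \<in> sets borel" for i
      using sets.range_disjointed_sets[of B borel] by (simp add: B_def image_subset_iff)
    show "disjoint_family (disjointed B)"
      by (rule disjoint_family_disjointed)
    show "(\<Union>i. disjointed B i) = UNIV"
      using cover by (simp add: UN_disjointed_eq)
    show "dist x y \<le> r" if "x \<in> disjointed B i" "y \<in> disjointed B i" for i x y
    proof -
      have "x \<in> B i" "y \<in> B i"
        using that disjointed_subset[of B i] by auto
      then show ?thesis
        using dist_triangle2[of x y "from_nat_into D i"] by (simp add: B_def dist_commute)
    qed
  qed
qed


section \<open>From packings to measures: the upper bound for the energy\<close>

lemma ennreal_inverse_inverse: "inverse (inverse a) = (a :: ennreal)"
proof (cases a)
  case (real x)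
  then show ?thesis
    by (cases "x = 0") (simp_all add: inverse_ennreal)
qed simp

lemma ennreal_le_inverse_commute:
  fixes a b :: ennreal
  assumes "a \<le> inverse b"
  shows "b \<le> inverse a"
proof (cases "a = 0 \<or> b = 0")
  case False
  with assms obtain x y where "a = ennreal x" "b = ennreal y" "0 < x" "0 < y"
    by (cases a; cases b) (auto simp: top_unique ennreal_eq_0_iff)
  with assms show ?thesis
    by (simp add: inverse_ennreal field_simps)
qed auto

text \<open>Dividing the weights by their sum \<open>W\<close> gives a probability measure whose
  potential at each \<open>x i\<close> is the packing sum divided by \<open>W\<close>, hence at most
  \<open>1 / W\<close>; averaging preserves this bound.\<close>

lemma min_energy_le_inverse_weight:
  fixes E :: "'a::euclidean_space set"
  assumes packing: "weighted_packing s r E k w x"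
  shows "min_energy s r E \<le> inverse (ennreal (\<Sum>i=1..k. w i))"
proof (cases "(\<Sum>i=1..k. w i) = 0")
  case True
  then show ?thesis
    by simp
next
  case False
  have k: "1 \<le> k" and x: "\<And>i. i \<in> {1..k} \<Longrightarrow> x i \<in> E" and w: "\<And>i. i \<in> {1..k} \<Longrightarrow> 0 \<le> w i"
    using packing by (auto simp: weighted_packing_def)
  have pot: "(\<Sum>j=1..k. w j * psi s ((x i - x j) /\<^sub>R r)) \<le> 1" if "i \<in> {1..k}" for i
  proof -
    have "(\<Sum>j=1..k. w j * psi s ((x i - x j) /\<^sub>R r)) \<le>
        (MAX i\<in>{1..k}. \<Sum>j=1..k. w j * psi s ((x i - x j) /\<^sub>R r))"
      using that by (intro Max_ge) auto
    then show ?thesis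
      using packing unfolding weighted_packing_def by linarith
  qed
  define W where "W = (\<Sum>i=1..k. w i)"
  have W: "0 < W"
    using False w sum_nonneg[of "{1..k}" w] by (simp add: W_def less_le)
  \<comment> \<open>The measure is pushed forward from the index set because the points
    \<open>x i\<close> need not be distinct.\<close>
  define P where "P = point_measure {1..k} (\<lambda>i. ennreal (w i / W))"
  define \<mu> where "\<mu> = distr P borel x"
  have x_meas: "x \<in> measurable P borel"
    by (simp add: P_def)
  have total: "(\<Sum>i=1..k. ennreal (w i / W)) = 1"
    using w W by (subst sum_ennreal) (auto simp: W_def sum_divide_distrib[symmetric])
  have space_P: "emeasure P (space P) = 1"
    using total by (simp add: P_def emeasure_point_measure_finite space_point_measure)
  then interpret P: prob_space P
    by (rule prob_spaceI)
  interpret \<mu>: prob_space \<mu>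
    unfolding \<mu>_def by (rule P.prob_space_distr[OF x_meas])
  have sets_mu: "sets \<mu> = sets borel"
    by (simp add: \<mu>_def)
  have S: "x ` {1..k} \<in> sets \<mu>"
    by (simp add: sets_mu finite_imp_closed)
  have "x -` x ` {1..k} \<inter> space P = space P"
    by (auto simp: P_def space_point_measure)
  then have one: "emeasure \<mu> (x ` {1..k}) = 1"
    using S space_P x_meas by (simp add: \<mu>_def emeasure_distr)
  then have null: "space \<mu> - x ` {1..k} \<in> null_sets \<mu>"
    using S by (auto simp: null_sets_def emeasure_compl \<mu>.emeasure_space_1)
  \<comment> \<open>\<open>E\<close> need not be Borel, but it is a finite set together with a
    subset of a null set.\<close>
  have E_sets: "E \<in> sets (completion \<mu>)"
    by (rule sets_completionI[OF _ _ null S, of _ "E - x ` {1..k}"])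
      (use x in \<open>auto simp: \<mu>_def\<close>)
  have "1 = emeasure (completion \<mu>) (x ` {1..k})"
    using S one by simp
  also have "\<dots> \<le> emeasure (completion \<mu>) E"
    using x E_sets by (intro emeasure_mono) auto
  finally have "emeasure (completion \<mu>) E = 1"
    using E_sets by (intro antisym) (auto simp: \<mu>.emeasure_le_1)
  then have \<mu>_in: "\<mu> \<in> prob_measures_on E"
    by (simp add: prob_measures_on_def sets_mu \<mu>.prob_space_axioms)
  have int: "(\<integral>\<^sup>+ y. f y \<partial>\<mu>) = (\<Sum>i=1..k. ennreal (w i / W) * f (x i))"
    if "f \<in> borel_measurable borel" for f
    unfolding \<mu>_def using that
    by (subst nn_integral_distr[OF x_meas]) (simp_all add: P_def nn_integral_point_measure_finite)
  have inner: "(\<integral>\<^sup>+ y. ennreal (psi s ((z - y) /\<^sub>R r)) \<partial>\<mu>) =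
      (\<Sum>j=1..k. ennreal (w j / W) * ennreal (psi s ((z - x j) /\<^sub>R r)))" for z
    by (rule int) measurable
  have bound: "(\<Sum>j=1..k. ennreal (w j / W) * ennreal (psi s ((x i - x j) /\<^sub>R r))) \<le>
      ennreal (1 / W)" if i: "i \<in> {1..k}" for i
  proof -
    have "(\<Sum>j=1..k. ennreal (w j / W) * ennreal (psi s ((x i - x j) /\<^sub>R r))) =
        (\<Sum>j=1..k. ennreal (w j * psi s ((x i - x j) /\<^sub>R r) / W))"
      using w W by (intro sum.cong) (simp_all add: ennreal_mult[symmetric] psi_nonneg)
    also have "\<dots> = ennreal ((\<Sum>j=1..k. w j * psi s ((x i - x j) /\<^sub>R r)) / W)"
      using w W by (subst sum_ennreal) (auto simp: psi_nonneg sum_divide_distrib)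
    also have "\<dots> \<le> ennreal (1 / W)"
      using pot[OF i] W by (intro ennreal_leI divide_right_mono) auto
    finally show ?thesis .
  qed
  have "min_energy s r E \<le>
      (\<integral>\<^sup>+ z. (\<integral>\<^sup>+ y. ennreal (psi s ((z - y) /\<^sub>R r)) \<partial>\<mu>) \<partial>\<mu>)"
    unfolding min_energy_def by (rule INF_lower[OF \<mu>_in])
  also have "\<dots> = (\<Sum>i=1..k. ennreal (w i / W) *
      (\<Sum>j=1..k. ennreal (w j / W) * ennreal (psi s ((x i - x j) /\<^sub>R r))))"
    unfolding inner by (rule int) measurable
  also have "\<dots> \<le> (\<Sum>i=1..k. ennreal (w i / W) * ennreal (1 / W))"
    by (intro sum_mono mult_left_mono bound) auto
  also have "\<dots> = ennreal (1 / W)"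
    by (simp only: sum_distrib_right[symmetric] total mult_1)
  also have "\<dots> = inverse (ennreal (\<Sum>i=1..k. w i))"
    unfolding W_def[symmetric] using W by (simp add: inverse_ennreal inverse_eq_divide)
  finally show ?thesis .
qed

lemma min_energy_le_inverse_packing_number:
  fixes E :: "'a::euclidean_space set"
  shows "min_energy s r E \<le> inverse (packing_number s r E)"
\<comment> \<open>With the inverse moved to the energy side, the supremum can be bounded one packing
  at a time.\<close>
proof (rule ennreal_le_inverse_commute)
  show "packing_number s r E \<le> inverse (min_energy s r E)"
    unfolding packing_number_def
    using min_energy_le_inverse_weight
    by (intro Sup_least) (blast intro: ennreal_le_inverse_commute)
qed

section \<open>From measures to packings: the lower bound for the energy\<close>

text \<open>The factor 8 is 4 times 2: the packing retains mass more than 1/4, and its masses are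
  divided by the potential bound \<open>2 * C * t\<close>. The premise \<open>fat\<close> is the
  estimate of \<open>fat_potential_bound\<close> at the fixed scale \<open>r\<close>.\<close>

lemma packing_number_ge:
  fixes E :: "'a::euclidean_space set"
  assumes C: "0 < C" and r: "0 < r" and t: "0 < t"
    and fat: "\<And>(\<mu> :: 'a measure) A u x. sets \<mu> = sets borel \<Longrightarrow> A \<in> sets borel \<Longrightarrow>
      (\<And>a. a \<in> A \<Longrightarrow> (\<integral>\<^sup>+ y. ennreal (psi s ((a - y) /\<^sub>R r)) \<partial>\<mu>) \<le> u) \<Longrightarrow> x \<in> A \<Longrightarrow>
      (\<integral>\<^sup>+ y. ennreal (fat_psi s ((x - y) /\<^sub>R r)) * indicator A y \<partial>\<mu>) \<le> ennreal C * u"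
    and \<mu>: "\<mu> \<in> prob_measures_on E"
    and energy: "(\<integral>\<^sup>+ x. (\<integral>\<^sup>+ y. ennreal (psi s ((x - y) /\<^sub>R r)) \<partial>\<mu>) \<partial>\<mu>) < ennreal t"
  shows "ennreal (1 / (8 * C * t)) \<le> packing_number s r E"
proof -
  interpret prob_space \<mu>
    using \<mu> by (simp add: prob_measures_on_def)
  have sets_mu [measurable_cong]: "sets \<mu> = sets borel"
    and E_one: "emeasure (completion \<mu>) E = 1"
    using \<mu> by (auto simp: prob_measures_on_def)
  have space_mu: "space \<mu> = UNIV"
    using sets_eq_imp_space_eq[OF sets_mu] by simp
  have "E \<in> sets (completion \<mu>)"
    using E_one by (metis emeasure_notin_sets zero_neq_one)
  \<comment> \<open>The main part of \<open>E\<close> in the completion is a Borel subset of full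
    measure.\<close>
  then obtain E' where E': "E' \<in> sets \<mu>" "E' \<subseteq> E" "emeasure \<mu> E' = 1"
    using E_one emeasure_completion main_part_sets main_part_null_part_Un by (metis Un_upper1)
  define U where "U x = (\<integral>\<^sup>+ y. ennreal (psi s ((x - y) /\<^sub>R r)) \<partial>\<mu>)" for x
  have U_meas [measurable]: "U \<in> borel_measurable \<mu>"
    unfolding U_def by measurable
  define A where "A = {x \<in> E'. U x \<le> ennreal (2 * t)}"
  have A_eq: "A = E' - {x \<in> space \<mu>. ennreal (2 * t) < U x}"
    by (auto simp: A_def space_mu)
  have high_sets: "{x \<in> space \<mu>. ennreal (2 * t) < U x} \<in> sets \<mu>"
    by measurable
  have A_mu: "A \<in> sets \<mu>"
    unfolding A_eq using E'(1) high_sets by blast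
  then have A_sets: "A \<in> sets borel"
    by (simp add: sets_mu)
  have A_E: "A \<subseteq> E"
    using E'(2) by (auto simp: A_def)
  have "emeasure \<mu> {x \<in> space \<mu>. ennreal (2 * t) < U x} \<le>
      emeasure \<mu> {x \<in> space \<mu>. 1 \<le> ennreal (1 / (2 * t)) * U x}"
  proof (intro emeasure_mono)
    show "{x \<in> space \<mu>. ennreal (2 * t) < U x} \<subseteq> {x \<in> space \<mu>. 1 \<le> ennreal (1 / (2 * t)) * U x}"
    proof safe
      fix x assume "ennreal (2 * t) < U x"
      then have "ennreal (1 / (2 * t)) * ennreal (2 * t) \<le> ennreal (1 / (2 * t)) * U x"
        by (intro mult_left_mono) auto
      then show "1 \<le> ennreal (1 / (2 * t)) * U x"
        using t by (simp add: ennreal_mult[symmetric])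
    qed
  qed measurable
  also have "\<dots> \<le> ennreal (1 / (2 * t)) * (\<integral>\<^sup>+ x. U x * indicator (space \<mu>) x \<partial>\<mu>)"
    by (rule nn_integral_Markov_inequality) measurable
  also have "\<dots> = ennreal (1 / (2 * t)) * (\<integral>\<^sup>+ x. U x \<partial>\<mu>)"
    by (simp add: space_mu)
  also have "\<dots> \<le> ennreal (1 / (2 * t)) * ennreal t"
    using energy unfolding U_def by (intro mult_left_mono) auto
  also have "\<dots> = ennreal (1 / 2)"
    using t by (simp add: ennreal_mult[symmetric])
  finally have high: "measure \<mu> {x \<in> space \<mu>. ennreal (2 * t) < U x} \<le> 1 / 2"
    unfolding emeasure_eq_measure by (subst (asm) ennreal_le_iff) simp_all
  have "measure \<mu> E' - measure \<mu> {x \<in> space \<mu>. ennreal (2 * t) < U x} \<le> measure \<mu> A"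
    unfolding A_eq using finite_measure_Diff'[OF E'(1) high_sets]
      finite_measure_mono[of "E' \<inter> {x \<in> space \<mu>. ennreal (2 * t) < U x}" _, OF _ high_sets]
    by auto
  moreover have "measure \<mu> E' = 1"
    using E'(3) by (simp add: measure_def)
  ultimately have A_half: "1 / 2 \<le> measure \<mu> A"
    using high by linarith

  obtain Q :: "nat \<Rightarrow> 'a set" where Q: "\<And>i. Q i \<in> sets borel" "disjoint_family Q"
    "(\<Union>i. Q i) = UNIV" "\<And>i x y. x \<in> Q i \<Longrightarrow> y \<in> Q i \<Longrightarrow> dist x y \<le> r"
    using countable_small_partition[OF r] by metis
  define m where "m i = measure \<mu> (A \<inter> Q i)" for i
  have "(\<lambda>i. m i) sums measure \<mu> (\<Union>i. A \<inter> Q i)"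
    unfolding m_def using Q(2) A_mu Q(1)
    by (intro finite_measure_UNION) (auto simp: disjoint_family_on_def sets_mu)
  moreover have "(\<Union>i. A \<inter> Q i) = A"
    using Q(3) by auto
  ultimately have "(\<lambda>n. \<Sum>i<n. m i) \<longlonglongrightarrow> measure \<mu> A"
    by (simp add: sums_def)
  \<comment> \<open>A packing is finite, so the countable partition is truncated; any threshold
    below 1/2 would do, and 1/4 is taken.\<close>
  then have "\<forall>\<^sub>F n in sequentially. 1 / 4 < (\<Sum>i<n. m i)"
    by (rule order_tendstoD) (use A_half in linarith)
  then obtain k where k: "1 / 4 < (\<Sum>i<k. m i)"
    by (auto simp: eventually_sequentially)
  then have k_pos: "1 \<le> k"
    by (cases k) auto
  have "A \<noteq> {}"
    using A_half by auto
  \<comment> \<open>Even for a piece that misses \<open>A\<close> the point is taken in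
    \<open>A\<close>, since packing points must lie in \<open>E\<close>; such a piece has mass
    0.\<close>
  then have "\<exists>p. p \<in> A \<and> (A \<inter> Q i \<noteq> {} \<longrightarrow> p \<in> Q i)" for i
    by blast
  then obtain p where p: "\<And>i. p i \<in> A" "\<And>i. A \<inter> Q i \<noteq> {} \<Longrightarrow> p i \<in> Q i"
    by metis

  \<comment> \<open>By \<open>psi_le_fat_psi\<close>, the kernel at \<open>p j\<close> is at most
    the enlarged kernel at every point of the same piece. Integrating over the disjoint pieces
    bounds the discrete potential by the enlarged potential of \<open>\<mu>\<close> on
    \<open>A\<close>, where \<open>U\<close> is at most \<open>2 * t\<close>.\<close>
  have pot: "(\<Sum>j<k. m j * psi s ((x - p j) /\<^sub>R r)) \<le> 2 * C * t" if x: "x \<in> A" for x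
  proof -
    have piece: "ennreal (m j * psi s ((x - p j) /\<^sub>R r)) \<le>
        (\<integral>\<^sup>+ y. ennreal (fat_psi s ((x - y) /\<^sub>R r)) * indicator (A \<inter> Q j) y \<partial>\<mu>)" for j
    proof -
      have "ennreal (m j * psi s ((x - p j) /\<^sub>R r)) =
          (\<integral>\<^sup>+ y. ennreal (psi s ((x - p j) /\<^sub>R r)) * indicator (A \<inter> Q j) y \<partial>\<mu>)"
        using A_mu Q(1)[of j]
        by (subst nn_integral_cmult_indicator)
          (auto simp: sets_mu m_def emeasure_eq_measure ennreal_mult psi_nonneg mult.commute)
      also have "\<dots> \<le>
          (\<integral>\<^sup>+ y. ennreal (fat_psi s ((x - y) /\<^sub>R r)) * indicator (A \<inter> Q j) y \<partial>\<mu>)"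
      proof (intro nn_integral_mono)
        fix y
        show "ennreal (psi s ((x - p j) /\<^sub>R r)) * indicator (A \<inter> Q j) y \<le>
            ennreal (fat_psi s ((x - y) /\<^sub>R r)) * indicator (A \<inter> Q j) y"
        proof (cases "y \<in> A \<inter> Q j")
          case True
          then have "dist y (p j) \<le> r"
            using p(2)[of j] Q(4) by blast
          then have "norm ((y - p j) /\<^sub>R r) \<le> 1"
            by (simp add: norm_diff_scaleR_inverse_le_iff[OF r] del: norm_scaleR)
          then have "psi s ((x - p j) /\<^sub>R r) \<le> fat_psi s ((x - y) /\<^sub>R r)"
            \<comment> \<open>The two arguments differ by
              \<open>(y - p j) /\<^sub>R r\<close>.\<close>
            by (intro psi_le_fat_psi) (simp add: scaleR_diff_right[symmetric] del: norm_scaleR)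
          then show ?thesis
            by (intro mult_right_mono ennreal_leI) auto
        qed simp
      qed
      finally show ?thesis .
    qed
    have "ennreal (\<Sum>j<k. m j * psi s ((x - p j) /\<^sub>R r)) =
        (\<Sum>j<k. ennreal (m j * psi s ((x - p j) /\<^sub>R r)))"
      by (simp add: m_def psi_nonneg sum_ennreal)
    also have "\<dots> \<le>
        (\<Sum>j<k. \<integral>\<^sup>+ y. ennreal (fat_psi s ((x - y) /\<^sub>R r)) * indicator (A \<inter> Q j) y \<partial>\<mu>)"
      by (intro sum_mono piece)
    also have "\<dots> =
        (\<integral>\<^sup>+ y. (\<Sum>j<k. ennreal (fat_psi s ((x - y) /\<^sub>R r)) * indicator (A \<inter> Q j) y) \<partial>\<mu>)"
    proof (intro nn_integral_sum[symmetric])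
      fix j
      have [measurable]: "A \<inter> Q j \<in> sets borel"
        using A_sets Q(1) by blast
      show "(\<lambda>y. ennreal (fat_psi s ((x - y) /\<^sub>R r)) * indicator (A \<inter> Q j) y) \<in>
          borel_measurable \<mu>"
        by measurable
    qed
    also have "\<dots> \<le> (\<integral>\<^sup>+ y. ennreal (fat_psi s ((x - y) /\<^sub>R r)) * indicator A y \<partial>\<mu>)"
    proof (intro nn_integral_mono)
      fix y
      have "(\<Sum>j<k. indicator (A \<inter> Q j) y :: ennreal) = indicator (\<Union>j<k. A \<inter> Q j) y"
        using Q(2) by (intro indicator_UN_disjoint[symmetric])
          (auto simp: disjoint_family_on_def)
      also have "\<dots> \<le> indicator A y"
        by (auto simp: indicator_def)
      finally show "(\<Sum>j<k. ennreal (fat_psi s ((x - y) /\<^sub>R r)) * indicator (A \<inter> Q j) y) \<le>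
          ennreal (fat_psi s ((x - y) /\<^sub>R r)) * indicator A y"
        unfolding sum_distrib_left[symmetric] by (intro mult_left_mono) auto
    qed
    also have "\<dots> \<le> ennreal C * ennreal (2 * t)"
      using x by (intro fat sets_mu A_sets) (auto simp: A_def U_def)
    also have "\<dots> = ennreal (2 * C * t)"
      using C t by (simp add: ennreal_mult[symmetric] mult_ac)
    finally show ?thesis
      using C t by simp
  qed

  \<comment> \<open>Division by the potential bound makes the packing sums at most 1; the index
    shift is needed because packings are numbered from 1.\<close>
  define w where "w i = m (i - 1) / (2 * C * t)" for i :: nat
  define x where "x i = p (i - 1)" for i :: nat
  have shift: "(\<Sum>i=1..k. f (i - 1)) = (\<Sum>i<k. f i)" for f :: "nat \<Rightarrow> real"
    by (rule sum.reindex_bij_witness[of _ Suc "\<lambda>i. i - 1"]) auto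
  have packed: "(\<Sum>j=1..k. w j * psi s ((x i - x j) /\<^sub>R r)) \<le> 1" for i
  proof -
    have "(\<Sum>j=1..k. w j * psi s ((x i - x j) /\<^sub>R r)) =
        (\<Sum>j<k. m j / (2 * C * t) * psi s ((x i - p j) /\<^sub>R r))"
      unfolding w_def x_def
      by (rule shift[of "\<lambda>j. m j / (2 * C * t) * psi s ((p (i - 1) - p j) /\<^sub>R r)"])
    also have "\<dots> = (\<Sum>j<k. m j * psi s ((x i - p j) /\<^sub>R r)) / (2 * C * t)"
      by (simp add: sum_divide_distrib)
    also have "\<dots> \<le> 1"
      using pot[of "x i"] p(1) C t by (simp add: x_def pos_divide_le_eq)
    finally show ?thesis .
  qed
  have "weighted_packing s r E k w x"
    unfolding weighted_packing_def
  proof (intro conjI ballI k_pos)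
    show "x i \<in> E" for i
      using p(1) A_E by (auto simp: x_def)
    show "0 \<le> w i" for i
      using C t by (simp add: w_def m_def)
    show "(MAX i\<in>{1..k}. \<Sum>j=1..k. w j * psi s ((x i - x j) /\<^sub>R r)) \<le> 1"
      using k_pos packed by (subst Max_le_iff) auto
  qed
  then have "ennreal (\<Sum>i=1..k. w i) \<le> packing_number s r E"
    unfolding packing_number_def by (intro Sup_upper) blast
  moreover have "1 / (8 * C * t) \<le> (\<Sum>i=1..k. w i)"
  proof -
    have "1 / (8 * C * t) = (1 / 4) / (2 * C * t)"
      by simp
    also have "\<dots> \<le> (\<Sum>i<k. m i) / (2 * C * t)"
      using k C t by (intro divide_right_mono) auto
    also have "\<dots> = (\<Sum>i=1..k. w i)"
      unfolding w_def using shift[of "\<lambda>i. m i / (2 * C * t)"] by (simp add: sum_divide_distrib)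
    finally show ?thesis .
  qed
  ultimately show ?thesis
    using ennreal_leI order_trans by blast
qed

text \<open>The constant is chosen before \<open>E\<close> and \<open>r\<close>, as the passage to
  the limit requires; it is \<open>1 / (8 * C)\<close> with \<open>C\<close> from
  \<open>fat_potential_bound\<close>.\<close>

lemma inverse_packing_number_le_min_energy:
  fixes s :: ennreal
  shows "\<exists>c>0. \<forall>(E :: 'a::euclidean_space set) r. 0 < r \<longrightarrow>
    ennreal c * inverse (packing_number s r E) \<le> min_energy s r E"
proof -
  obtain C where C: "0 < C" and fat: "\<And>(\<mu> :: 'a measure) A r t x.
    sets \<mu> = sets borel \<Longrightarrow> A \<in> sets borel \<Longrightarrow> 0 < r \<Longrightarrow>
    (\<And>a. a \<in> A \<Longrightarrow> (\<integral>\<^sup>+ y. ennreal (psi s ((a - y) /\<^sub>R r)) \<partial>\<mu>) \<le> t) \<Longrightarrow> x \<in> A \<Longrightarrow>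
    (\<integral>\<^sup>+ y. ennreal (fat_psi s ((x - y) /\<^sub>R r)) * indicator A y \<partial>\<mu>) \<le> ennreal C * t"
    by (fact fat_potential_bound)
  show ?thesis
  proof (intro exI[of _ "1 / (8 * C)"] conjI allI impI)
    fix E :: "'a set" and r :: real assume r: "0 < r"
    show "ennreal (1 / (8 * C)) * inverse (packing_number s r E) \<le> min_energy s r E"
      unfolding min_energy_def
    \<comment> \<open>Comparing with every \<open>T\<close> strictly above the energy supplies a
      positive \<open>t\<close> even when the energy is 0.\<close>
    proof (rule INF_greatest, rule dense_ge)
      fix \<mu> T assume \<mu>: "\<mu> \<in> prob_measures_on E"
        and T: "(\<integral>\<^sup>+ x. (\<integral>\<^sup>+ y. ennreal (psi s ((x - y) /\<^sub>R r)) \<partial>\<mu>) \<partial>\<mu>) < T"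
      show "ennreal (1 / (8 * C)) * inverse (packing_number s r E) \<le> T"
      proof (cases T)
        case (real t)
        with T have t: "0 < t"
          by (cases "t = 0") auto
        have "ennreal (1 / (8 * C * t)) \<le> packing_number s r E"
          by (rule packing_number_ge[OF C r t _ \<mu>]) (rule fat[OF _ _ r], use T real in simp_all)
        then have "inverse (packing_number s r E) \<le> inverse (ennreal (1 / (8 * C * t)))"
          by (metis ennreal_inverse_inverse ennreal_le_inverse_commute)
        also have "\<dots> = ennreal (8 * C * t)"
          using C t by (simp add: inverse_ennreal inverse_eq_divide)
        finally have "inverse (packing_number s r E) \<le> ennreal (8 * C * t)" .
        then have "ennreal (1 / (8 * C)) * inverse (packing_number s r E) \<le>
            ennreal (1 / (8 * C)) * ennreal (8 * C * t)"
          by (intro mult_left_mono) auto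
        also have "\<dots> = T"
          using C t real by (simp add: ennreal_mult[symmetric])
        finally show ?thesis .
      qed simp
    qed
  qed (use C in simp)
qed

theorem theorem4p1:
  fixes E :: "(real ^ 'n) set" and s :: ennreal
  assumes "analytic_set E" and "0 < s"
  shows "upper_box_dim s E =
    Limsup (at_right 0) (\<lambda>r. elog (min_energy s r E) / ereal (ln r))"
proof -
  obtain c where "0 < c" and
    "\<And>r. 0 < r \<Longrightarrow> ennreal c * inverse (packing_number s r E) \<le> min_energy s r E"
    using inverse_packing_number_le_min_energy[of s, where ?'a = "real ^ 'n"] by blast
  then show ?thesis
    unfolding upper_box_dim_def
    using min_energy_le_inverse_packing_number by (rule Limsup_elog_quotient_eq)
qed

end
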